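(* $\pi_{\mathrm{cch}}(P)\le 6$.
   Context: $P$ is the infinite path graph with vertex set $\mathbb N$ (consecutive integers adjacent). A list assignment is a function $L$ assigning to each $v\in P$ a nonempty set $L(v)\subset\mathbb N$. An $L$-coloring of $P$ is a function $c:P\to\mathbb N$ with $c(v)\in L(v)$ for every $v\in P$. A string is a square if it is of the form $xx$ for some nonempty word $x$; a coloring $c$ of $P$ is square free if no block of consecutive entries of the sequence of colors along $P$ is a square. $\pi_{\mathrm{cch}}(P)$ is the least $n$ such that for every list assignment $L$ with $|L(v)|=n$ for all $v\in P$, there is an $L$-computable (i.e. computable relative to the oracle $L$) square free $L$-coloring of $P$. *)

theory Defs
  imports Main "HOL-Library.Extended_Nat" "HOL-Library.Nat_Bijection"
begin

text \<open>
  The class of total functions recursive in an oracle \<open>A\<close>: the least class containing zero,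
  successor, the projections and the characteristic function of \<open>A\<close>, closed under composition,
  primitive recursion and minimization of regular functions (those for which the search
  succeeds on all arguments).  A \<open>k\<close>-ary function is a function on lists that is only ever
  applied to lists of length \<open>k\<close>; its values on other lists carry no meaning.
\<close>

inductive recursive_in :: "nat set \<Rightarrow> nat \<Rightarrow> (nat list \<Rightarrow> nat) \<Rightarrow> bool" for A :: "nat set" where
  zero: "recursive_in A k (\<lambda>xs. 0)"
| succ: "recursive_in A 1 (\<lambda>xs. Suc (xs ! 0))"
| proj: "i < k \<Longrightarrow> recursive_in A k (\<lambda>xs. xs ! i)"
| query: "recursive_in A 1 (\<lambda>xs. if xs ! 0 \<in> A then 1 else 0)"
| comp: "recursive_in A (length gs) f \<Longrightarrow> \<forall>g \<in> set gs. recursive_in A k g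
    \<Longrightarrow> recursive_in A k (\<lambda>xs. f (map (\<lambda>g. g xs) gs))"
| prim_rec: "recursive_in A k f \<Longrightarrow> recursive_in A (Suc (Suc k)) g
    \<Longrightarrow> recursive_in A (Suc k)
          (\<lambda>ys. rec_nat (f (tl ys)) (\<lambda>n r. g (n # r # tl ys)) (hd ys))"
| minim: "recursive_in A (Suc k) g \<Longrightarrow> \<forall>xs. length xs = k \<longrightarrow> (\<exists>y. g (y # xs) = 0)
    \<Longrightarrow> recursive_in A k (\<lambda>xs. LEAST y. g (y # xs) = 0)"

definition computable_in :: "nat set \<Rightarrow> (nat \<Rightarrow> nat) \<Rightarrow> bool" where
  "computable_in A f \<longleftrightarrow> (\<exists>F. recursive_in A 1 F \<and> (\<forall>x. F [x] = f x))"

definition list_assignment :: "(nat \<Rightarrow> nat set) \<Rightarrow> bool" where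
  "list_assignment L \<longleftrightarrow> (\<forall>v. L v \<noteq> {})"

definition list_coloring :: "(nat \<Rightarrow> nat set) \<Rightarrow> (nat \<Rightarrow> nat) \<Rightarrow> bool" where
  "list_coloring L c \<longleftrightarrow> (\<forall>v. c v \<in> L v)"

definition square :: "'a list \<Rightarrow> bool" where
  "square w \<longleftrightarrow> (\<exists>x. x \<noteq> [] \<and> w = x @ x)"

text \<open>The vertices of the path are the natural numbers in order, so its blocks of consecutive
  vertices are the intervals \<open>[i..<j]\<close>.\<close>

definition square_free :: "(nat \<Rightarrow> nat) \<Rightarrow> bool" where
  "square_free c \<longleftrightarrow> (\<forall>i j. \<not> square (map c [i..<j]))"

text \<open>A list assignment serves as an oracle through the membership relation \<open>k \<in> L v\<close>.  When all
  lists have one known finite size, this has the same computational power as the function giving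
  canonical codes of the finite sets \<open>L v\<close>.\<close>

definition oracle_of :: "(nat \<Rightarrow> nat set) \<Rightarrow> nat set" where
  "oracle_of L = {prod_encode (v, k) | v k. k \<in> L v}"

definition computably_square_free_choosable :: "nat \<Rightarrow> bool" where
  "computably_square_free_choosable n \<longleftrightarrow>
     (\<forall>L. list_assignment L \<and> (\<forall>v. finite (L v) \<and> card (L v) = n) \<longrightarrow>
        (\<exists>c. computable_in (oracle_of L) c \<and> list_coloring L c \<and> square_free c))"

text \<open>The least \<open>n\<close> is taken over \<open>n \<ge> 1\<close>, since lists are nonempty and \<open>n = 0\<close> would hold
  vacuously.  The value is \<open>\<infinity>\<close> if there is no such \<open>n\<close>.\<close>

definition pi_cch_path :: enat where
  "pi_cch_path = Inf (enat ` {n. n \<ge> 1 \<and> computably_square_free_choosable n})"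

end

theory Submission
  imports Defs
begin

text \<open>
  Colour the vertices greedily.  A pair \<open>(n, s)\<close> is active at stage \<open>m\<close> if the last \<open>s\<close> colours
  agree with those \<open>n\<close> places earlier; it is a threat of a square of period \<open>n\<close> that is \<open>n - s\<close>
  colours away, and receives the weight \<open>3 ^ (s - n)\<close>.  Let \<open>V\<close> be the total weight, so that a
  completed square forces \<open>V \<ge> 1\<close>.  A given active pair survives for at most one choice of the
  next colour, and its weight is then multiplied by 3; the new pairs with \<open>s = 0\<close> have total
  weight below \<open>1/3 + 1/9 + \<dots> = 1/2\<close>.  Summed over the 6 colours of a list, the new values of
  \<open>V\<close> are therefore below \<open>3 V + 6 / 2\<close>, so if \<open>V < 1\<close> then some colour keeps \<open>V < 1\<close>.  Picking
  the least such colour is a search that is computable in the list assignment.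
\<close>

section \<open>Closure properties of computable functions\<close>

abbreviation pi1 :: "nat \<Rightarrow> nat" where "pi1 x \<equiv> fst (prod_decode x)"
abbreviation pi2 :: "nat \<Rightarrow> nat" where "pi2 x \<equiv> snd (prod_decode x)"

definition decidable_in :: "nat set \<Rightarrow> (nat \<Rightarrow> bool) \<Rightarrow> bool" where
  "decidable_in A P \<longleftrightarrow> computable_in A (\<lambda>x. of_bool (P x))"

text \<open>Instances of \<open>comp\<close> for a fixed arity: with the argument list written out
  instead of a \<open>map\<close>, they serve as introduction rules.\<close>

lemma recursive_in_comp1:
  assumes "recursive_in A 1 f" "recursive_in A k g"
  shows "recursive_in A k (\<lambda>xs. f [g xs])"
  using recursive_in.comp[of A "[g]" f k] assms by simp

lemma recursive_in_comp2:
  assumes "recursive_in A 2 f" "recursive_in A k g" "recursive_in A k h"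
  shows "recursive_in A k (\<lambda>xs. f [g xs, h xs])"
  using recursive_in.comp[of A "[g, h]" f k] assms by (simp add: numeral_2_eq_2)

lemma recursive_in_prim_rec1:
  assumes "recursive_in A 0 f" "recursive_in A 2 g"
  shows "recursive_in A 1 (\<lambda>ys. rec_nat (f (tl ys)) (\<lambda>n r. g (n # r # tl ys)) (hd ys))"
  using recursive_in.prim_rec[of A 0 f g] assms by (simp add: numeral_2_eq_2)

lemma recursive_in_prim_rec2:
  assumes "recursive_in A 1 f" "recursive_in A 3 g"
  shows "recursive_in A 2 (\<lambda>ys. rec_nat (f (tl ys)) (\<lambda>n r. g (n # r # tl ys)) (hd ys))"
  using recursive_in.prim_rec[of A 1 f g] assms by (simp add: numeral_2_eq_2 numeral_3_eq_3)

lemma computable_in_comp1: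
  assumes "recursive_in A 1 F" "\<And>a. F [a] = f a" "computable_in A g"
  shows "computable_in A (\<lambda>x. f (g x))"
proof -
  obtain G where "recursive_in A 1 G" "\<And>x. G [x] = g x"
    using assms(3) unfolding computable_in_def by blast
  then show ?thesis
    unfolding computable_in_def using recursive_in_comp1[OF assms(1), of 1 G] assms(2)
    by (intro exI[of _ "\<lambda>xs. F [G xs]"]) simp
qed

lemma computable_in_comp2:
  assumes "recursive_in A 2 F" "\<And>a b. F [a, b] = f a b" "computable_in A g" "computable_in A h"
  shows "computable_in A (\<lambda>x. f (g x) (h x))"
proof -
  obtain G where "recursive_in A 1 G" "\<And>x. G [x] = g x"
    using assms(3) unfolding computable_in_def by blast
  moreover obtain H where "recursive_in A 1 H" "\<And>x. H [x] = h x"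
    using assms(4) unfolding computable_in_def by blast
  ultimately show ?thesis
    unfolding computable_in_def using recursive_in_comp2[OF assms(1), of 1 G H] assms(2)
    by (intro exI[of _ "\<lambda>xs. F [G xs, H xs]"]) simp
qed

lemma computable_in_comp: "computable_in A f \<Longrightarrow> computable_in A g \<Longrightarrow> computable_in A (\<lambda>x. f (g x))"
  unfolding computable_in_def[of A f] using computable_in_comp1 by blast

lemma computable_in_id: "computable_in A (\<lambda>x. x)"
  unfolding computable_in_def using recursive_in.proj[of 0 1 A] by force

lemma computable_in_0: "computable_in A (\<lambda>x. 0)"
  unfolding computable_in_def using recursive_in.zero by blast

lemma computable_in_Suc: "computable_in A f \<Longrightarrow> computable_in A (\<lambda>x. Suc (f x))"
  by (rule computable_in_comp1[OF recursive_in.succ]) simp_all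

lemma computable_in_const: "computable_in A (\<lambda>x. n)"
  by (induction n) (simp_all add: computable_in_0 computable_in_Suc)

lemma decidable_in_mem_oracle:
  assumes "computable_in A f"
  shows "decidable_in A (\<lambda>x. f x \<in> A)"
  unfolding decidable_in_def
  by (rule computable_in_comp1[OF recursive_in.query _ assms, where f = "\<lambda>a. of_bool (a \<in> A)"]) simp

section \<open>Arithmetic and the Cantor pairing function\<close>

lemma recursive_in_plus: "\<exists>F. recursive_in A 2 F \<and> (\<forall>a b. F [a, b] = a + b)"
proof -
  \<comment> \<open>The form \<open>[e] ! 0\<close> is the function of rule \<open>succ\<close>
    applied to a list and left unreduced, so that the closure rules match syntactically.\<close>
  let ?F = "\<lambda>ys. rec_nat (tl ys ! 0) (\<lambda>n r. Suc ([(n # r # tl ys) ! 1] ! 0)) (hd ys)"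
  have "recursive_in A 2 ?F"
    by (rule recursive_in_prim_rec2) (intro recursive_in.zero recursive_in.proj recursive_in_comp1[OF recursive_in.succ]; simp)+
  moreover have "?F [a, b] = a + b" for a b
    by (induction a) simp_all
  ultimately show ?thesis by blast
qed

lemma recursive_in_pred: "\<exists>F. recursive_in A 1 F \<and> (\<forall>a. F [a] = a - 1)"
proof -
  let ?F = "\<lambda>ys. rec_nat 0 (\<lambda>n r. (n # r # tl ys) ! 0) (hd ys)"
  have "recursive_in A 1 ?F"
    by (rule recursive_in_prim_rec1) (intro recursive_in.zero recursive_in.proj recursive_in_comp1[OF recursive_in.succ]; simp)+
  moreover have "?F [a] = a - 1" for a
    by (cases a) simp_all
  ultimately show ?thesis by blast
qed

lemma recursive_in_minus: "\<exists>F. recursive_in A 2 F \<and> (\<forall>a b. F [a, b] = a - b)"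
proof -
  obtain P where P: "recursive_in A 1 P" "\<And>a. P [a] = a - 1"
    using recursive_in_pred by blast
  let ?F = "\<lambda>ys. rec_nat (tl ys ! 0) (\<lambda>n r. P [(n # r # tl ys) ! 1]) (hd ys)"
  have "recursive_in A 2 ?F"
    by (rule recursive_in_prim_rec2) (intro recursive_in.zero recursive_in.proj recursive_in_comp1[OF recursive_in.succ] recursive_in_comp1[OF P(1)]; simp)+
  \<comment> \<open>The recursion runs on the first argument, here the subtrahend, so the arguments
    are exchanged.\<close>
  then have "recursive_in A 2 (\<lambda>xs. ?F [xs ! 1, xs ! 0])"
    by (rule recursive_in_comp2) (simp_all add: recursive_in.proj)
  moreover have "?F [b, a] = a - b" for a b
    by (induction b) (simp_all add: P(2))
  ultimately show ?thesis
    by (intro exI[of _ "\<lambda>xs. ?F [xs ! 1, xs ! 0]"]) simp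
qed

lemma computable_in_plus:
  "computable_in A f \<Longrightarrow> computable_in A g \<Longrightarrow> computable_in A (\<lambda>x. f x + g x)"
  using recursive_in_plus computable_in_comp2 by blast

lemma computable_in_minus:
  "computable_in A f \<Longrightarrow> computable_in A g \<Longrightarrow> computable_in A (\<lambda>x. f x - g x)"
  using recursive_in_minus computable_in_comp2 by blast

lemma recursive_in_triangle: "\<exists>F. recursive_in A 1 F \<and> (\<forall>a. F [a] = triangle a)"
proof -
  obtain P where P: "recursive_in A 2 P" "\<And>a b. P [a, b] = a + b"
    using recursive_in_plus by blast
  let ?F = "\<lambda>ys. rec_nat 0 (\<lambda>n r. P [(n # r # tl ys) ! 1, Suc ([(n # r # tl ys) ! 0] ! 0)]) (hd ys)"
  have "recursive_in A 1 ?F"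
    by (rule recursive_in_prim_rec1) (intro recursive_in.zero recursive_in.proj recursive_in_comp1[OF recursive_in.succ] recursive_in_comp2[OF P(1)]; simp)+
  moreover have "?F [a] = triangle a" for a
    by (induction a) (simp_all add: P(2))
  ultimately show ?thesis by blast
qed

lemma recursive_in_prod_encode: "\<exists>F. recursive_in A 2 F \<and> (\<forall>a b. F [a, b] = prod_encode (a, b))"
proof -
  obtain P where P: "recursive_in A 2 P" "\<And>a b. P [a, b] = a + b"
    using recursive_in_plus by blast
  obtain T where T: "recursive_in A 1 T" "\<And>a. T [a] = triangle a"
    using recursive_in_triangle by blast
  have "recursive_in A 2 (\<lambda>xs. P [T [P [xs ! 0, xs ! 1]], xs ! 0])"
    by (intro recursive_in_comp2[OF P(1)] recursive_in_comp1[OF T(1)] recursive_in.proj) simp_all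
  then show ?thesis
    by (intro exI[of _ "\<lambda>xs. P [T [P [xs ! 0, xs ! 1]], xs ! 0]"]) (simp add: P T prod_encode_def)
qed

lemma computable_in_prod_encode:
  "computable_in A f \<Longrightarrow> computable_in A g \<Longrightarrow> computable_in A (\<lambda>x. prod_encode (f x, g x))"
  using recursive_in_prod_encode computable_in_comp2[where f = "\<lambda>a b. prod_encode (a, b)"] by blast

lemma le_triangle: "n \<le> triangle n"
  by (induction n) simp_all

lemma triangle_mono: "m \<le> n \<Longrightarrow> triangle m \<le> triangle n"
  by (induction n) (auto simp: le_Suc_eq)

text \<open>The code of \<open>(a, b)\<close> is \<open>triangle (a + b) + a\<close>, which lies
  below the next triangular number; the search thus recovers the diagonal \<open>a + b\<close>, from
  which both components follow.\<close>

lemma Least_triangle_prod_encode: "(LEAST k. prod_encode (a, b) < triangle (Suc k)) = a + b"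
proof (rule Least_equality)
  fix k
  assume "prod_encode (a, b) < triangle (Suc k)"
  then show "a + b \<le> k"
    using triangle_mono[of "Suc k" "a + b"] by (force simp: prod_encode_def)
qed (simp add: prod_encode_def)

lemma computable_in_prod_decode:
  assumes "computable_in A f"
  shows "computable_in A (\<lambda>x. pi1 (f x))" "computable_in A (\<lambda>x. pi2 (f x))"
proof -
  obtain M where M: "recursive_in A 2 M" "\<And>a b. M [a, b] = a - b"
    using recursive_in_minus by blast
  obtain T where T: "recursive_in A 1 T" "\<And>a. T [a] = triangle a"
    using recursive_in_triangle by blast
  \<comment> \<open>In truncated subtraction, \<open>Suc x - triangle (Suc y)\<close> is zero
    exactly if \<open>x < triangle (Suc y)\<close>.\<close>
  let ?G = "\<lambda>xs. M [Suc ([xs ! 1] ! 0), T [Suc ([xs ! 0] ! 0)]]"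
  have "recursive_in A (Suc 1) ?G"
    by (intro recursive_in_comp2[OF M(1)] recursive_in_comp1[OF T(1)]
        recursive_in_comp1[OF recursive_in.succ] recursive_in.proj) simp_all
  moreover have G: "?G (y # xs) = 0 \<longleftrightarrow> xs ! 0 < triangle (Suc y)" for y xs
    by (simp add: M T flip: less_Suc_eq_le)
  have "\<exists>y. ?G (y # xs) = 0" for xs
    unfolding G using le_triangle[of "Suc (xs ! 0)"] Suc_le_eq by blast
  ultimately have "recursive_in A 1 (\<lambda>xs. LEAST y. ?G (y # xs) = 0)"
    by (intro recursive_in.minim) blast+
  then have "recursive_in A 1 (\<lambda>xs. LEAST y. xs ! 0 < triangle (Suc y))"
    unfolding G .
  then have k: "computable_in A (\<lambda>x. LEAST y. x < triangle (Suc y))" (is "computable_in A ?k")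
    unfolding computable_in_def by (intro exI conjI) (assumption, simp)
  have "computable_in A triangle"
    unfolding computable_in_def using T by blast
  then have 1: "computable_in A (\<lambda>x. x - triangle (?k x))"
    by (intro computable_in_minus computable_in_id computable_in_comp[OF _ k])
  have eq: "pi1 x = x - triangle (?k x)" "pi2 x = ?k x - (x - triangle (?k x))" for x
  proof -
    obtain a b where x: "x = prod_encode (a, b)"
      by (metis prod_decode_inverse surj_pair)
    then have "?k x = a + b" "pi1 x = a" "pi2 x = b"
      using Least_triangle_prod_encode[of a b] by (simp_all del: triangle_Suc)
    moreover have "x = triangle (a + b) + a"
      using x by (simp add: prod_encode_def)
    ultimately show "pi1 x = x - triangle (?k x)" "pi2 x = ?k x - (x - triangle (?k x))"
      by (simp_all del: triangle_Suc)
  qed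
  show "computable_in A (\<lambda>x. pi1 (f x))"
    unfolding eq by (rule computable_in_comp[OF 1 assms])
  show "computable_in A (\<lambda>x. pi2 (f x))"
    unfolding eq using computable_in_comp[OF computable_in_minus[OF k 1] assms] .
qed

text \<open>In the following rules the context of a bound variable is kept in a single number: its old
  value is paired with the bound variable.\<close>

lemma computable_in_rec_nat:
  assumes "computable_in A f"
    and "computable_in A (\<lambda>p. g (pi1 p) (pi1 (pi2 p)) (pi2 (pi2 p)))"
    and "computable_in A t"
  shows "computable_in A (\<lambda>x. rec_nat (f x) (\<lambda>n r. g n r x) (t x))"
proof -
  obtain F where F: "recursive_in A 1 F" "\<And>x. F [x] = f x"
    using assms(1) unfolding computable_in_def by blast
  obtain G where G: "recursive_in A 1 G" "\<And>p. G [p] = g (pi1 p) (pi1 (pi2 p)) (pi2 (pi2 p))"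
    using assms(2) unfolding computable_in_def by blast
  obtain P where P: "recursive_in A 2 P" "\<And>a b. P [a, b] = prod_encode (a, b)"
    using recursive_in_prod_encode by blast
  let ?g = "\<lambda>xs. G [P [xs ! 0, P [xs ! 1, xs ! 2]]]"
  have "recursive_in A (Suc (Suc 1)) ?g"
    by (intro recursive_in_comp1[OF G(1)] recursive_in_comp2[OF P(1)] recursive_in.proj) simp_all
  from recursive_in.prim_rec[OF F(1) this]
  have "recursive_in A 2 (\<lambda>ys. rec_nat (F (tl ys)) (\<lambda>n r. ?g (n # r # tl ys)) (hd ys))"
    by (simp add: numeral_2_eq_2)
  then show ?thesis
    by (rule computable_in_comp2[OF _ _ assms(3) computable_in_id, where f = "\<lambda>a x. rec_nat (f x) (\<lambda>n r. g n r x) a"])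
      (simp add: F G P)
qed

lemma computable_in_Least:
  assumes "decidable_in A (\<lambda>p. P (pi1 p) (pi2 p))" and "\<And>x. \<exists>y. P y x"
  shows "computable_in A (\<lambda>x. LEAST y. P y x)"
proof -
  \<comment> \<open>Minimization looks for a zero, so the truth value is negated.\<close>
  obtain G where G: "recursive_in A 1 G" "\<And>p. G [p] = 1 - of_bool (P (pi1 p) (pi2 p))"
    using computable_in_minus[OF computable_in_const assms(1)[unfolded decidable_in_def], of 1]
    unfolding computable_in_def by blast
  obtain E where E: "recursive_in A 2 E" "\<And>a b. E [a, b] = prod_encode (a, b)"
    using recursive_in_prod_encode by blast
  let ?G = "\<lambda>xs. G [E [xs ! 0, xs ! 1]]"
  have "recursive_in A (Suc 1) ?G"
    by (intro recursive_in_comp1[OF G(1)] recursive_in_comp2[OF E(1)] recursive_in.proj) simp_all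
  moreover have eq: "?G (y # xs) = 0 \<longleftrightarrow> P y (xs ! 0)" for y xs
    by (simp add: G E)
  ultimately have "recursive_in A 1 (\<lambda>xs. LEAST y. ?G (y # xs) = 0)"
    using assms(2) by (intro recursive_in.minim) (simp_all only:, blast)
  then have "recursive_in A 1 (\<lambda>xs. LEAST y. P y (xs ! 0))"
    unfolding eq .
  then show ?thesis
    unfolding computable_in_def by (intro exI conjI) (assumption, simp)
qed

lemma computable_in_sum:
  assumes "computable_in A (\<lambda>p. g (pi1 p) (pi2 p))" and "computable_in A t"
  shows "computable_in A (\<lambda>x. \<Sum>j<t x. g j x)"
proof -
  \<comment> \<open>In the recursion below, the step also receives the partial sum, which sits
    between \<open>j\<close> and \<open>x\<close> and is skipped here.\<close>
  have "computable_in A (\<lambda>p. g (pi1 p) (pi2 (pi2 p)))"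
    using computable_in_comp[OF assms(1) computable_in_prod_encode[OF computable_in_prod_decode(1)[OF computable_in_id]
        computable_in_prod_decode(2)[OF computable_in_prod_decode(2)[OF computable_in_id]]]] by simp
  then have "computable_in A (\<lambda>x. rec_nat 0 (\<lambda>j r. r + g j x) (t x))"
    by (intro computable_in_rec_nat computable_in_plus computable_in_0 computable_in_prod_decode computable_in_id assms)
  moreover have "rec_nat 0 (\<lambda>j r. r + g j x) n = (\<Sum>j<n. g j x)" for n x
    by (induction n) simp_all
  ultimately show ?thesis by simp
qed

lemma computable_in_times:
  assumes "computable_in A f" "computable_in A g"
  shows "computable_in A (\<lambda>x. f x * g x)"
proof -
  have "computable_in A (\<lambda>x. \<Sum>j<f x. g x)"
    by (intro computable_in_sum computable_in_comp[OF assms(2)] computable_in_prod_decode computable_in_id assms(1))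
  then show ?thesis by simp
qed

lemma computable_in_power:
  assumes "computable_in A f" "computable_in A g"
  shows "computable_in A (\<lambda>x. f x ^ g x)"
proof -
  have "computable_in A (\<lambda>x. rec_nat 1 (\<lambda>j r. f x * r) (g x))"
    by (intro computable_in_rec_nat computable_in_times computable_in_const computable_in_comp[OF assms(1)]
        computable_in_prod_decode computable_in_id assms(2))
  moreover have "rec_nat 1 (\<lambda>j r. f x * r) n = f x ^ n" for n x
    by (induction n) simp_all
  ultimately show ?thesis by simp
qed

section \<open>Decidable predicates\<close>

lemma decidable_in_not:
  assumes "decidable_in A P"
  shows "decidable_in A (\<lambda>x. \<not> P x)"
proof -
  have "computable_in A (\<lambda>x. 1 - of_bool (P x))"
    using assms unfolding decidable_in_def by (intro computable_in_minus computable_in_const)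
  moreover have "(\<lambda>x. 1 - of_bool (P x)) = (\<lambda>x. of_bool (\<not> P x) :: nat)"
    by (simp add: fun_eq_iff)
  ultimately show ?thesis
    by (simp only: decidable_in_def)
qed

lemma decidable_in_conj: "decidable_in A P \<Longrightarrow> decidable_in A Q \<Longrightarrow> decidable_in A (\<lambda>x. P x \<and> Q x)"
  unfolding decidable_in_def of_bool_conj by (rule computable_in_times)

lemma decidable_in_less:
  assumes "computable_in A f" "computable_in A g"
  shows "decidable_in A (\<lambda>x. f x < g x)"
proof -
  have "computable_in A (\<lambda>x. 1 - (1 - (g x - f x)))"
    by (intro computable_in_minus computable_in_const assms)
  moreover have "(\<lambda>x. 1 - (1 - (g x - f x))) = (\<lambda>x. of_bool (f x < g x))"
    by (auto simp: fun_eq_iff)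
  ultimately show ?thesis
    unfolding decidable_in_def by simp
qed

lemma decidable_in_eq:
  assumes "computable_in A f" "computable_in A g"
  shows "decidable_in A (\<lambda>x. f x = g x)"
proof -
  have "decidable_in A (\<lambda>x. \<not> f x < g x \<and> \<not> g x < f x)"
    by (intro decidable_in_conj decidable_in_not decidable_in_less assms)
  then show ?thesis by (simp add: not_less eq_iff conj_commute)
qed

text \<open>The number of counterexamples below the bound is a computable sum, to be compared with
  zero.\<close>

lemma decidable_in_all_less:
  assumes "decidable_in A (\<lambda>p. P (pi1 p) (pi2 p))" and "computable_in A t"
  shows "decidable_in A (\<lambda>x. \<forall>j<t x. P j x)"
proof -
  have "computable_in A (\<lambda>x. \<Sum>j<t x. of_bool (\<not> P j x))"
    by (intro computable_in_sum assms decidable_in_not[unfolded decidable_in_def] assms[unfolded decidable_in_def])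
  then have "decidable_in A (\<lambda>x. (\<Sum>j<t x. of_bool (\<not> P j x)) = (0::nat))"
    by (intro decidable_in_eq computable_in_const)
  moreover have "(\<Sum>j<n. of_bool (\<not> P j x)) = (0::nat) \<longleftrightarrow> (\<forall>j<n. P j x)" for n x
    by (auto simp: sum_eq_0_iff)
  ultimately show ?thesis by simp
qed

lemma decidable_in_imp:
  assumes "decidable_in A P" "decidable_in A Q"
  shows "decidable_in A (\<lambda>x. P x \<longrightarrow> Q x)"
proof -
  have "decidable_in A (\<lambda>x. \<not> (P x \<and> \<not> Q x))"
    by (intro decidable_in_not decidable_in_conj assms)
  then show ?thesis by simp
qed

lemma computable_in_of_bool: "decidable_in A P \<Longrightarrow> computable_in A (\<lambda>x. of_bool (P x))"
  by (simp add: decidable_in_def)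

lemmas computable_in_intros =
  computable_in_of_bool computable_in_rec_nat computable_in_sum computable_in_power computable_in_times
  computable_in_plus computable_in_minus computable_in_prod_encode computable_in_prod_decode
  computable_in_Suc computable_in_id computable_in_const
  decidable_in_conj decidable_in_imp decidable_in_less decidable_in_eq decidable_in_all_less

section \<open>Weights\<close>

text \<open>The colours are read backwards, \<open>d j\<close> being the \<open>j\<close>-th last one of \<open>m\<close> colours, and the total
  weight is scaled by \<open>3 ^ m\<close>.  The summation index \<open>n\<close> stands for the period \<open>Suc n\<close>.\<close>

definition weight :: "(nat \<Rightarrow> nat) \<Rightarrow> nat \<Rightarrow> nat" where
  "weight d m = (\<Sum>n<m. \<Sum>s<m - n. of_bool (\<forall>j<s. d j = d (j + Suc n)) * 3 ^ (m - Suc n + s))"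

text \<open>Only the first \<open>m\<close> entries are read: \<open>j < s\<close> and
  \<open>s < m - n\<close> give \<open>j + Suc n < m\<close>.\<close>

lemma weight_cong: "(\<And>j. j < m \<Longrightarrow> d j = e j) \<Longrightarrow> weight d m = weight e m"
  unfolding weight_def
  by (intro sum.cong refl arg_cong2[where f = "(*)"] arg_cong[where f = of_bool] all_cong) auto

text \<open>The terms with \<open>s = 0\<close> form the geometric sum. A match of length
  \<open>Suc s\<close> consists of the new condition \<open>a = d n\<close> at the front and an old
  match of length \<open>s\<close>; the factor \<open>of_bool (a = d n)\<close> isolates the
  dependence on \<open>a\<close>.\<close>

lemma weight_Suc:
  "weight (case_nat a d) (Suc m) = (\<Sum>n<Suc m. 3 ^ n) +
    (\<Sum>n<m. \<Sum>s<m - n. of_bool (a = d n) * (of_bool (\<forall>j<s. d j = d (j + Suc n)) * 3 ^ (m - n + Suc s)))"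
proof -
  have "(\<Sum>s<Suc m - n. of_bool (\<forall>j<s. case_nat a d j = case_nat a d (j + Suc n)) * 3 ^ (Suc m - Suc n + s) :: nat) =
      3 ^ (m - n) + (\<Sum>s<m - n. of_bool (a = d n) * (of_bool (\<forall>j<s. d j = d (j + Suc n)) * 3 ^ (m - n + Suc s)))"
    (is "?l = _") if "n \<le> m" for n
  proof -
    have "?l = (\<Sum>s<Suc (m - n). of_bool (\<forall>j<s. case_nat a d j = case_nat a d (j + Suc n)) * 3 ^ (m - n + s) :: nat)"
      using that by (simp add: Suc_diff_le)
    also have "\<dots> = 3 ^ (m - n) + (\<Sum>s<m - n. of_bool (\<forall>j<Suc s. case_nat a d j = case_nat a d (j + Suc n)) * 3 ^ (m - n + Suc s))"
      by (subst sum.lessThan_Suc_shift) (simp del: add_Suc_right)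
    finally show ?thesis
      by (simp add: All_less_Suc2 of_bool_conj mult.assoc)
  qed
  then have "weight (case_nat a d) (Suc m) = (\<Sum>n<Suc m. 3 ^ (m - n) +
      (\<Sum>s<m - n. of_bool (a = d n) * (of_bool (\<forall>j<s. d j = d (j + Suc n)) * 3 ^ (m - n + Suc s))))"
    unfolding weight_def by (intro sum.cong refl) simp
  \<comment> \<open>For \<open>n = m\<close> the inner sum is empty.\<close>
  also have "\<dots> = (\<Sum>n<Suc m. 3 ^ (m - n)) +
      (\<Sum>n<m. \<Sum>s<m - n. of_bool (a = d n) * (of_bool (\<forall>j<s. d j = d (j + Suc n)) * 3 ^ (m - n + Suc s)))"
    by (simp add: sum.distrib)
  also have "(\<Sum>n<Suc m. 3 ^ (m - n)) = (\<Sum>n<Suc m. 3 ^ n :: nat)"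
    using sum.nat_diff_reindex[of "\<lambda>n. 3 ^ n :: nat" "Suc m"] by simp
  finally show ?thesis .
qed

text \<open>Averaging: the six new weights add up to at most
  \<open>3 * (3 ^ Suc m - 1) + 9 * weight d m\<close>, which is less than
  \<open>6 * 3 ^ Suc m\<close>.\<close>

lemma exists_weight_less:
  assumes "finite S" "card S = 6" "weight d m < 3 ^ m"
  shows "\<exists>a\<in>S. weight (case_nat a d) (Suc m) < 3 ^ Suc m"
proof (rule ccontr)
  let ?w = "\<lambda>n s. of_bool (\<forall>j<s. d j = d (j + Suc n)) * 3 ^ (m - n + Suc s) :: nat"
  have geo: "2 * (\<Sum>n<k. 3 ^ n) + 1 = (3 ^ k :: nat)" for k
    by (induction k) simp_all
  assume "\<not> ?thesis"
  then have "6 * 3 ^ Suc m \<le> (\<Sum>a\<in>S. weight (case_nat a d) (Suc m))"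
    using sum_bounded_below[of S "3 ^ Suc m" "\<lambda>a. weight (case_nat a d) (Suc m)"] assms(2)
    by (simp add: not_less)
  also have "\<dots> = 6 * (\<Sum>n<Suc m. 3 ^ n) + (\<Sum>n<m. \<Sum>s<m - n. \<Sum>a\<in>S. of_bool (a = d n) * ?w n s)"
    unfolding weight_Suc sum.distrib using assms(2)
    by (simp add: sum.swap[of _ S] del: sum.lessThan_Suc)
  also have "(\<Sum>n<m. \<Sum>s<m - n. \<Sum>a\<in>S. of_bool (a = d n) * ?w n s) \<le> (\<Sum>n<m. \<Sum>s<m - n. ?w n s)"
  proof (intro sum_mono)
    fix n s
    have "(\<Sum>a\<in>S. of_bool (a = d n) :: nat) \<le> 1"
      using assms(1) by (simp add: of_bool_def)
    then show "(\<Sum>a\<in>S. of_bool (a = d n) * ?w n s) \<le> ?w n s"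
      unfolding sum_distrib_right[symmetric] using mult_right_mono by fastforce
  qed
  \<comment> \<open>One factor 3 comes from the longer match, the other from the scaling by
    \<open>3 ^ Suc m\<close> instead of \<open>3 ^ m\<close>.\<close>
  also have "(\<Sum>n<m. \<Sum>s<m - n. ?w n s) = 9 * weight d m"
    unfolding weight_def sum_distrib_left
  proof (intro sum.cong refl)
    fix n s assume "n \<in> {..<m}"
    then have "m - n + Suc s = Suc (Suc (m - Suc n + s))" by auto
    then show "?w n s = 9 * (of_bool (\<forall>j<s. d j = d (j + Suc n)) * 3 ^ (m - Suc n + s))"
      by (simp only: power_Suc)
  qed
  finally show False
    using assms(3) geo[of "Suc m"] by (simp del: sum.lessThan_Suc)
qed

text \<open>A square of period \<open>p\<close> that ends just before position \<open>k\<close>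
  makes a single term of the weight at stage \<open>k\<close> equal to \<open>3 ^ k\<close>.\<close>

lemma square_free_if_weight_less:
  assumes "\<And>m. weight (\<lambda>j. c (m - Suc j)) m < 3 ^ m"
  shows "square_free c"
  unfolding square_free_def square_def
proof (intro allI notI)
  fix i k
  assume "\<exists>x. x \<noteq> [] \<and> map c [i..<k] = x @ x"
  then obtain x where x: "x \<noteq> []" "map c [i..<k] = x @ x" by blast
  define p where "p = length x"
  have p: "p > 0"
    using x(1) by (simp add: p_def)
  have "k - i = 2 * p"
    using arg_cong[OF x(2), of length] by (simp add: p_def)
  then have k: "k = i + 2 * p"
    using p by simp
  have eq: "c (i + j) = c (i + j + p)" if "j < p" for j
  proof -
    have "c (i + j) = map c [i..<k] ! j" "c (i + j + p) = map c [i..<k] ! (j + p)"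
      using that k by (simp_all add: add.assoc)
    then show ?thesis
      unfolding x(2) using that by (simp add: nth_append p_def)
  qed
  let ?d = "\<lambda>j. c (k - Suc j)"
  let ?w = "\<lambda>n s. of_bool (\<forall>j<s. ?d j = ?d (j + Suc n)) * 3 ^ (k - Suc n + s) :: nat"
  \<comment> \<open>Reading backwards sends offset \<open>j\<close> to \<open>p - Suc j\<close>
    within each half.\<close>
  have "?d j = ?d (j + p)" if "j < p" for j
    using eq[of "p - Suc j"] that k by (simp add: mult_2 add.assoc)
  then have "3 ^ k = ?w (p - 1) p"
    using p k by simp
  \<comment> \<open>The index \<open>s = p\<close> is in range because \<open>k\<close> is at least
    \<open>2 * p\<close>.\<close>
  also have "\<dots> \<le> (\<Sum>s<k - (p - 1). ?w (p - 1) s)"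
    using p k by (intro member_le_sum) auto
  also have "\<dots> \<le> weight ?d k"
    unfolding weight_def using p k by (intro member_le_sum[of _ _ "\<lambda>n. \<Sum>s<k - n. ?w n s"]) auto
  finally show False
    using assms[of k] by simp
qed

section \<open>The greedy colouring\<close>

text \<open>The number \<open>h\<close> codes the list of the previous colours, the last one first, as in
  \<open>list_encode\<close>.  The premise in \<open>greedy_choice\<close> makes the search succeed for all \<open>m\<close> and \<open>h\<close>,
  including those that do not occur, as is needed for the minimization of a regular function.\<close>

definition entry :: "nat \<Rightarrow> nat \<Rightarrow> nat" where
  "entry h j = pi1 (rec_nat h (\<lambda>_ r. pi2 (r - 1)) j - 1)"

definition greedy_choice :: "(nat \<Rightarrow> nat set) \<Rightarrow> nat \<Rightarrow> nat \<Rightarrow> nat" where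
  "greedy_choice L m h =
    (LEAST a. weight (entry h) m < 3 ^ m \<longrightarrow>
      a \<in> L m \<and> weight (entry (Suc (prod_encode (a, h)))) (Suc m) < 3 ^ Suc m)"

definition greedy_history :: "(nat \<Rightarrow> nat set) \<Rightarrow> nat \<Rightarrow> nat" where
  "greedy_history L = rec_nat 0 (\<lambda>m h. Suc (prod_encode (greedy_choice L m h, h)))"

definition greedy :: "(nat \<Rightarrow> nat set) \<Rightarrow> nat \<Rightarrow> nat" where
  "greedy L m = greedy_choice L m (greedy_history L m)"

lemma entry_Suc: "entry (Suc (prod_encode (a, h))) = case_nat a (entry h)"
proof
  fix j
  \<comment> \<open>\<open>rec_nat\<close> adds steps on the outside, so an induction is needed to
    see that the innermost one strips the head \<open>a\<close>.\<close>
  have "rec_nat (Suc (prod_encode (a, h))) (\<lambda>_ r. pi2 (r - 1)) (Suc j) = rec_nat h (\<lambda>_ r. pi2 (r - 1)) j" for j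
    by (induction j) simp_all
  then show "entry (Suc (prod_encode (a, h))) j = case_nat a (entry h) j"
    by (cases j) (simp_all only: entry_def nat.case, simp)
qed

lemma computable_in_entry:
  "computable_in A f \<Longrightarrow> computable_in A g \<Longrightarrow> computable_in A (\<lambda>x. entry (f x) (g x))"
  unfolding entry_def by (intro computable_in_intros)

lemma computable_in_weight:
  assumes "computable_in A f" "computable_in A g"
  shows "computable_in A (\<lambda>x. weight (entry (f x)) (g x))"
proof -
  \<comment> \<open>With both arguments as components of one input, only projections occur under the
    bound variables; \<open>f\<close> and \<open>g\<close> enter by composition.\<close>
  have "computable_in A (\<lambda>x. weight (entry (pi1 x)) (pi2 x))"
    unfolding weight_def by (intro computable_in_intros computable_in_entry)
  from computable_in_comp[OF this computable_in_prod_encode[OF assms]] show ?thesis by simp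
qed

lemma mem_oracle_of: "prod_encode (v, k) \<in> oracle_of L \<longleftrightarrow> k \<in> L v"
  by (simp add: oracle_of_def)

lemma greedy_history_Suc:
  "entry (greedy_history L (Suc m)) = case_nat (greedy L m) (entry (greedy_history L m))"
  by (simp add: greedy_history_def greedy_def entry_Suc)

lemma entry_greedy_history: "j < m \<Longrightarrow> entry (greedy_history L m) j = greedy L (m - Suc j)"
proof (induction m arbitrary: j)
  case (Suc m)
  then show ?case unfolding greedy_history_Suc by (cases j) auto
qed simp

section \<open>Correctness and computability of the greedy colouring for lists of size six\<close>

context
  fixes L :: "nat \<Rightarrow> nat set"
  assumes L: "\<And>v. finite (L v) \<and> card (L v) = 6"
begin

lemma ex_greedy_choice:
  "\<exists>a. weight (entry h) m < 3 ^ m \<longrightarrow>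
    a \<in> L m \<and> weight (entry (Suc (prod_encode (a, h)))) (Suc m) < 3 ^ Suc m"
  unfolding entry_Suc using exists_weight_less[of "L m" "entry h" m] L[of m] by blast

lemma greedy_choice_correct:
  assumes "weight (entry h) m < 3 ^ m"
  shows "greedy_choice L m h \<in> L m \<and> weight (case_nat (greedy_choice L m h) (entry h)) (Suc m) < 3 ^ Suc m"
  using LeastI_ex[OF ex_greedy_choice] assms unfolding greedy_choice_def entry_Suc by blast

text \<open>The invariant that makes the premise in \<open>greedy_choice\<close> true along the
  actual history.\<close>

lemma weight_greedy_history: "weight (entry (greedy_history L m)) m < 3 ^ m"
proof (induction m)
  case 0
  then show ?case by (simp add: weight_def)
next
  case (Suc m)
  then show ?case
    unfolding greedy_history_Suc unfolding greedy_def using greedy_choice_correct by blast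
qed

lemma list_coloring_greedy: "list_coloring L (greedy L)"
  unfolding list_coloring_def greedy_def
  using greedy_choice_correct weight_greedy_history by blast

lemma square_free_greedy: "square_free (greedy L)"
proof (rule square_free_if_weight_less)
  fix m
  show "weight (\<lambda>j. greedy L (m - Suc j)) m < 3 ^ m"
    using weight_greedy_history[of m] weight_cong[of m "entry (greedy_history L m)"]
    by (simp add: entry_greedy_history)
qed

lemma computable_in_greedy_choice:
  "computable_in (oracle_of L) (\<lambda>x. greedy_choice L (pi1 x) (pi2 x))"
  \<comment> \<open>Membership in \<open>L m\<close> becomes an oracle query;
    \<open>ex_greedy_choice\<close> then shows that the search always succeeds.\<close>
  unfolding greedy_choice_def mem_oracle_of[symmetric]
  by (intro computable_in_Least computable_in_intros computable_in_weight decidable_in_mem_oracle)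
    (use ex_greedy_choice in \<open>simp only: mem_oracle_of\<close>)

lemma computable_in_greedy: "computable_in (oracle_of L) (greedy L)"
proof -
  note choice = computable_in_comp[OF computable_in_greedy_choice computable_in_prod_encode, simplified]
  show ?thesis
    unfolding greedy_def greedy_history_def by (intro computable_in_intros choice)
qed

end

theorem theorem5p15: "pi_cch_path \<le> 6"
proof -
  have "computably_square_free_choosable 6"
    unfolding computably_square_free_choosable_def
    using computable_in_greedy list_coloring_greedy square_free_greedy by blast
  then show ?thesis
    unfolding pi_cch_path_def numeral_eq_enat by (intro Inf_lower imageI) simp
qed

end
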